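(* Every compact $T_2$ (nonempty) space in which no point is a $G_\delta$ is destructible.
   Context: A point $p$ of a space $X$ is a $G_\delta$ point if $\{p\}$ is a countable intersection of open subsets of $X$. A forcing notion $\mathbb P$ is countably closed if every decreasing sequence in $\mathbb P$ indexed by a countable ordinal has a lower bound in $\mathbb P$. If $\langle X,\mathcal T\rangle$ is a topological space in the ground model, then in a forcing extension $X$ is regarded as a space with the topology that has $\mathcal T$ as an open base. A Lindelöf space is indestructible if it remains Lindelöf (in this sense) in every forcing extension by a countably closed forcing notion; a Lindelöf space that is not indestructible is called destructible. *)

theory Defs
  imports "HOL-Analysis.Analysis"
begin

text \<open>
  A forcing notion is a nonempty preorder \<open>P\<close> with carrier \<open>Field P\<close>; \<open>(q, p) \<in> P\<close> says
  that \<open>q\<close> is stronger than \<open>p\<close> (\<open>q \<le> p\<close>).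
\<close>

definition forcing_notion :: "'p rel \<Rightarrow> bool" where
  "forcing_notion P \<longleftrightarrow> Preorder P \<and> P \<noteq> {}"

text \<open>
  Up to isomorphism the countable ordinals are exactly the well-orders of subsets of \<^typ>\<open>nat\<close>.
\<close>

definition countably_closed :: "'p rel \<Rightarrow> bool" where
  "countably_closed P \<longleftrightarrow>
     (\<forall>(\<alpha> :: nat rel) f. Well_order \<alpha> \<and> f ` Field \<alpha> \<subseteq> Field P \<and> (\<forall>(i, j) \<in> \<alpha>. (f j, f i) \<in> P)
        \<longrightarrow> (\<exists>q \<in> Field P. \<forall>i \<in> Field \<alpha>. (q, f i) \<in> P))"

text \<open>
  \<^bold>\<open>Names.\<close> As usual, a \<open>P\<close>-name is a set of pairs (name, condition), and its value in the
  extension by a generic \<open>G\<close> is the set of the values of those first components that are paired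
  with a member of \<open>G\<close>. Names are stratified by types. A point \<open>x :: 'a\<close> (an individual of the
  ground model) is its own name; subsets of \<open>'a\<close> in the extension are named by \<open>('a, 'p) pname\<close>,
  families of such subsets by \<open>(('a, 'p) pname, 'p) pname\<close>; a pair of names is a name of the
  ordered pair. Every set of the respective rank in the extension has a name of this form.

  \<^bold>\<open>Forcing.\<close> A sentence of the forcing language is represented by the predicate on conditions
  ``\<open>p\<close> forces it'' (for \<open>p \<in> Field P\<close>). The clauses are those of the usual definition of the
  forcing relation; by the forcing theorem, \<open>p\<close> forces a sentence iff the sentence holds in
  every generic extension whose generic filter contains \<open>p\<close>.
\<close>

type_synonym ('x, 'p) pname = "('x \<times> 'p) set"

type_synonym 'p sentence = "'p \<Rightarrow> bool"

definition fand :: "'p sentence \<Rightarrow> 'p sentence \<Rightarrow> 'p sentence"  (infixr \<open>fand\<close> 35) where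
  "(\<phi> fand \<psi>) = (\<lambda>p. \<phi> p \<and> \<psi> p)"

text \<open>
  \<open>N\<close> is the set of names over which the quantifier ranges: \<open>UNIV\<close> for an unbounded quantifier
  over all names of a type, and a ground-model set \<open>A\<close> for a quantifier bounded by (the
  canonical name of) \<open>A\<close>.
\<close>

definition fall :: "'n set \<Rightarrow> ('n \<Rightarrow> 'p sentence) \<Rightarrow> 'p sentence" where
  "fall N \<phi> = (\<lambda>p. \<forall>\<tau> \<in> N. \<phi> \<tau> p)"

definition eq_ground :: "'a \<Rightarrow> 'a \<Rightarrow> 'p sentence" where
  "eq_ground x y = (\<lambda>p. x = y)"

definition eq_pair :: "('x \<Rightarrow> 'x \<Rightarrow> 'p sentence) \<Rightarrow> ('y \<Rightarrow> 'y \<Rightarrow> 'p sentence)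
    \<Rightarrow> 'x \<times> 'y \<Rightarrow> 'x \<times> 'y \<Rightarrow> 'p sentence" where
  "eq_pair eqx eqy = (\<lambda>(\<sigma>, \<tau>) (\<sigma>', \<tau>'). eqx \<sigma> \<sigma>' fand eqy \<tau> \<tau>')"

context
  fixes P :: "'p rel"
begin

definition fneg :: "'p sentence \<Rightarrow> 'p sentence" where
  "fneg \<phi> = (\<lambda>p. \<forall>q. (q, p) \<in> P \<longrightarrow> \<not> \<phi> q)"

definition fimp :: "'p sentence \<Rightarrow> 'p sentence \<Rightarrow> 'p sentence"  (infixr \<open>fimp\<close> 25) where
  "(\<phi> fimp \<psi>) = fneg (\<phi> fand fneg \<psi>)"

definition fiff :: "'p sentence \<Rightarrow> 'p sentence \<Rightarrow> 'p sentence"  (infixr \<open>fiff\<close> 25) where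
  "(\<phi> fiff \<psi>) = ((\<phi> fimp \<psi>) fand (\<psi> fimp \<phi>))"

definition fex :: "'n set \<Rightarrow> ('n \<Rightarrow> 'p sentence) \<Rightarrow> 'p sentence" where
  "fex N \<phi> = fneg (fall N (\<lambda>\<tau>. fneg (\<phi> \<tau>)))"

text \<open>
  Membership and equality of names of sets, relative to the forced equality \<open>eq\<close> of names
  of their elements: \<open>p\<close> forces \<open>\<tau> \<in> \<sigma>\<close> iff the conditions \<open>r\<close> such that for some
  \<open>(\<pi>, s) \<in> \<sigma>\<close> one has \<open>r \<le> s\<close> and \<open>r\<close> forces \<open>\<tau> = \<pi>\<close> are dense below \<open>p\<close>.
\<close>

definition mem :: "('x \<Rightarrow> 'x \<Rightarrow> 'p sentence) \<Rightarrow> 'x \<Rightarrow> ('x, 'p) pname \<Rightarrow> 'p sentence" where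
  "mem eq \<tau> \<sigma> = (\<lambda>p. \<forall>q. (q, p) \<in> P \<longrightarrow>
     (\<exists>r. (r, q) \<in> P \<and> (\<exists>(\<pi>, s) \<in> \<sigma>. (r, s) \<in> P \<and> eq \<tau> \<pi> r)))"

definition eq_set :: "('x \<Rightarrow> 'x \<Rightarrow> 'p sentence)
    \<Rightarrow> ('x, 'p) pname \<Rightarrow> ('x, 'p) pname \<Rightarrow> 'p sentence" where
  "eq_set eq \<sigma> \<sigma>' = (\<lambda>p. \<forall>\<pi> \<in> fst ` (\<sigma> \<union> \<sigma>'). \<forall>q. (q, p) \<in> P \<longrightarrow> (mem eq \<pi> \<sigma> q \<longleftrightarrow> mem eq \<pi> \<sigma>' q))"

definition check :: "'a set \<Rightarrow> ('a, 'p) pname" where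
  "check A = A \<times> Field P"

abbreviation mem_pt :: "'a \<Rightarrow> ('a, 'p) pname \<Rightarrow> 'p sentence"  (infix \<open>in0\<close> 50) where
  "x in0 U \<equiv> mem eq_ground x U"

abbreviation eq_sub :: "('a, 'p) pname \<Rightarrow> ('a, 'p) pname \<Rightarrow> 'p sentence"  (infix \<open>eq1\<close> 50) where
  "U eq1 V \<equiv> eq_set eq_ground U V"

abbreviation mem_sub :: "('a, 'p) pname \<Rightarrow> (('a, 'p) pname, 'p) pname \<Rightarrow> 'p sentence"
    (infix \<open>in1\<close> 50) where
  "U in1 \<U> \<equiv> mem (eq_set eq_ground) U \<U>"

text \<open>
  \<open>U\<close> is open in the topology of the extension, which has the ground-model topology of \<open>X\<close> as
  an open base.
\<close>

definition ext_open :: "'a topology \<Rightarrow> ('a, 'p) pname \<Rightarrow> 'p sentence" where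
  "ext_open X U =
     fall UNIV (\<lambda>x. x in0 U fimp
       fex {B. openin X B} (\<lambda>B. x in0 check B fand fall UNIV (\<lambda>y. y in0 check B fimp y in0 U)))"

text \<open>\<open>\<Union>\<U> = X\<close>\<close>

definition ext_covers :: "'a topology \<Rightarrow> (('a, 'p) pname, 'p) pname \<Rightarrow> 'p sentence" where
  "ext_covers X \<U> =
     fall UNIV (\<lambda>x. fex UNIV (\<lambda>U. U in1 \<U> fand x in0 U) fiff x in0 check (topspace X))"

definition ext_subset ::
    "(('a, 'p) pname, 'p) pname \<Rightarrow> (('a, 'p) pname, 'p) pname \<Rightarrow> 'p sentence" where
  "ext_subset \<V> \<U> = fall UNIV (\<lambda>V. V in1 \<V> fimp V in1 \<U>)"

text \<open>
  In the extension there is an injective function \<open>f\<close> from \<open>\<V>\<close> to the natural numbers; \<open>f\<close> is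
  named as a set of ordered pairs.
\<close>

definition ext_countable :: "(('a, 'p) pname, 'p) pname \<Rightarrow> 'p sentence" where
  "ext_countable \<V> =
     fex UNIV (\<lambda>f :: (('a, 'p) pname \<times> nat, 'p) pname.
       let app = (\<lambda>V n. mem (eq_pair (eq_set eq_ground) eq_ground) (V, n) f) in
         fall UNIV (\<lambda>V. V in1 \<V> fiff fex UNIV (\<lambda>n. app V n)) fand
         fall UNIV (\<lambda>V. fall UNIV (\<lambda>m. fall UNIV (\<lambda>n.
           (app V m fand app V n) fimp eq_ground m n))) fand
         fall UNIV (\<lambda>V. fall UNIV (\<lambda>W. fall UNIV (\<lambda>n.
           (app V n fand app W n) fimp V eq1 W))))"

text \<open>``\<open>X\<close> is Lindelof in the extension''\<close>

definition ext_Lindelof :: "'a topology \<Rightarrow> 'p sentence" where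
  "ext_Lindelof X =
     fall UNIV (\<lambda>\<U>.
       (fall UNIV (\<lambda>U. U in1 \<U> fimp ext_open X U) fand ext_covers X \<U>) fimp
       fex UNIV (\<lambda>\<V>. ext_countable \<V> fand ext_subset \<V> \<U> fand ext_covers X \<V>))"

end

text \<open>
  HOL cannot quantify over types inside a formula, so the type of the conditions of the
  forcing notions is a parameter. Destructibility with conditions of any one type implies
  destructibility in the sense of arbitrary forcing notions.
\<close>

definition indestructible :: "'p itself \<Rightarrow> 'a topology \<Rightarrow> bool" where
  "indestructible (_ :: 'p itself) X \<longleftrightarrow> Lindelof_space X \<and>
     (\<forall>P :: 'p rel. forcing_notion P \<and> countably_closed P \<longrightarrow> (\<forall>p \<in> Field P. ext_Lindelof P X p))"

definition destructible :: "'p itself \<Rightarrow> 'a topology \<Rightarrow> bool" where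
  "destructible (T :: 'p itself) X \<longleftrightarrow> Lindelof_space X \<and> \<not> indestructible T X"

end

theory Submission
  imports Defs
begin

text \<open>
  Force with the nonempty closed \<open>G\<^sub>\<delta>\<close> subsets of \<open>X\<close>, ordered by inclusion. By compactness this
  is countably closed. Let \<open>G\<close> be generic. As no nonempty closed \<open>G\<^sub>\<delta>\<close> set is a singleton, every
  condition can be shrunk to miss any given point, so the sets \<open>X - F\<close> with \<open>F \<in> G\<close> form an
  open cover of \<open>X\<close>. It has no countable subcover: by countable closure a condition can be
  shrunk to one that is contained in \<open>F\<^sub>n\<close> for every member \<open>X - F\<^sub>n\<close> of the subcover, and
  then none of its points is covered.
\<close>

section \<open>The forcing relation\<close>

text \<open>The defined implication is the negation of \<open>\<phi>\<close> together with the
  negation of \<open>\<psi>\<close>, so \<open>\<psi>\<close> is obtained only after one more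
  strengthening. For this reason the arguments below keep passing to smaller conditions.\<close>

lemma fimp_iff: "fimp P \<phi> \<psi> p \<longleftrightarrow> (\<forall>q. (q, p) \<in> P \<longrightarrow> \<phi> q \<longrightarrow> (\<exists>r. (r, q) \<in> P \<and> \<psi> r))"
  by (auto simp: fimp_def fneg_def fand_def)

lemma fex_iff: "fex P N \<phi> p \<longleftrightarrow> (\<forall>q. (q, p) \<in> P \<longrightarrow> (\<exists>\<tau>\<in>N. \<exists>r. (r, q) \<in> P \<and> \<phi> \<tau> r))"
  by (auto simp: fex_def fneg_def fall_def)

lemma fall_iff: "fall N \<phi> p \<longleftrightarrow> (\<forall>\<tau>\<in>N. \<phi> \<tau> p)"
  by (simp add: fall_def)

lemma fand_iff: "(\<phi> fand \<psi>) p \<longleftrightarrow> \<phi> p \<and> \<psi> p"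
  by (simp add: fand_def)

lemma fiff_iff: "fiff P \<phi> \<psi> p \<longleftrightarrow> fimp P \<phi> \<psi> p \<and> fimp P \<psi> \<phi> p"
  by (simp add: fiff_def fand_def)

lemma fimpE:
  assumes "fimp P \<phi> \<psi> p" "(q, p) \<in> P" "\<phi> q"
  obtains r where "(r, q) \<in> P" "\<psi> r"
  using assms fimp_iff by metis

lemma fexE:
  assumes "fex P N \<phi> p" "(q, p) \<in> P"
  obtains \<tau> r where "\<tau> \<in> N" "(r, q) \<in> P" "\<phi> \<tau> r"
  using assms fex_iff by metis

lemma fallD: "fall N \<phi> p \<Longrightarrow> \<tau> \<in> N \<Longrightarrow> \<phi> \<tau> p"
  by (simp add: fall_def)

section \<open>Monotonicity and congruence of forced membership and equality\<close>

lemma mem_mono: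
  assumes "trans P" "mem P eq \<tau> \<sigma> p" "(q, p) \<in> P"
  shows "mem P eq \<tau> \<sigma> q"
  using assms unfolding mem_def by (meson transD)

lemma eq_set_mono:
  assumes "trans P" "eq_set P eq \<sigma> \<tau> p" "(q, p) \<in> P"
  shows "eq_set P eq \<sigma> \<tau> q"
  using assms unfolding eq_set_def by (meson transD)

lemma eq_set_sym: "eq_set P eq \<sigma> \<tau> p \<Longrightarrow> eq_set P eq \<tau> \<sigma> p"
  unfolding eq_set_def by (metis sup_commute)

lemma eq_set_refl: "eq_set P eq \<sigma> \<sigma> p"
  by (simp add: eq_set_def)

text \<open>The name \<open>check P A\<close> pairs each element of \<open>A\<close> with every
  condition, and equality of ground-model points does not depend on the condition. So no condition
  can change the answer given by the ground model.\<close>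

lemma mem_check_iff:
  assumes "Preorder P" "p \<in> Field P"
  shows "mem P eq_ground x (check P A) p \<longleftrightarrow> x \<in> A"
proof -
  have "refl_on (Field P) P"
    using assms(1) by (simp add: preorder_on_def)
  then have *: "(q, q) \<in> P" if "q \<in> Field P" for q
    using that by (simp add: refl_on_def)
  show ?thesis
  proof
    assume "mem P eq_ground x (check P A) p"
    then show "x \<in> A"
      using *[OF assms(2)] unfolding mem_def check_def eq_ground_def by blast
  next
    assume x: "x \<in> A"
    have "\<exists>r. (r, q) \<in> P \<and> (\<exists>(\<pi>, s)\<in>check P A. (r, s) \<in> P \<and> eq_ground x \<pi> r)"
      if "(q, p) \<in> P" for q
      using x *[OF FieldI1[OF that]] FieldI1[OF that]
      by (intro exI[of _ q] conjI bexI[of _ "(x, q)"]) (auto simp: check_def eq_ground_def)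
    then show "mem P eq_ground x (check P A) p"
      unfolding mem_def by blast
  qed
qed

text \<open>\<open>eq_set\<close> compares memberships only of first components of the two names.
  Points are their own names, so a point forced into \<open>U\<close> literally is a first component
  of \<open>U\<close>, and the comparison applies to it.\<close>

lemma mem_eq_set:
  assumes "Preorder P" "p \<in> Field P"
    and "eq_set P eq_ground U V p" "mem P eq_ground x U p"
  shows "mem P eq_ground x V p"
proof -
  have pp: "(p, p) \<in> P"
    using assms(1,2) by (simp add: preorder_on_def refl_on_def)
  with assms(4) have "x \<in> fst ` U"
    unfolding mem_def eq_ground_def by force
  with assms(3,4) pp show ?thesis
    unfolding eq_set_def by blast
qed

section \<open>The forcing notion of closed \<open>G\<^sub>\<delta>\<close> sets\<close>

definition closed_gdeltas :: "'a topology \<Rightarrow> 'a set set" where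
  "closed_gdeltas X = {F. closedin X F \<and> gdelta_in X F \<and> F \<noteq> {}}"

definition gdelta_forcing :: "'a topology \<Rightarrow> 'a set rel" where
  "gdelta_forcing X = {(F, E). F \<in> closed_gdeltas X \<and> E \<in> closed_gdeltas X \<and> F \<subseteq> E}"

lemma in_gdelta_forcing:
  "(F, E) \<in> gdelta_forcing X \<longleftrightarrow> F \<in> closed_gdeltas X \<and> E \<in> closed_gdeltas X \<and> F \<subseteq> E"
  by (simp add: gdelta_forcing_def)

lemma Field_gdelta_forcing: "Field (gdelta_forcing X) = closed_gdeltas X"
  by (auto simp: gdelta_forcing_def Field_def)

lemma topspace_in_closed_gdeltas: "topspace X \<noteq> {} \<Longrightarrow> topspace X \<in> closed_gdeltas X"
  by (simp add: closed_gdeltas_def)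

lemma Preorder_gdelta_forcing: "Preorder (gdelta_forcing X)"
  unfolding preorder_on_def Field_gdelta_forcing
  by (auto simp: refl_on_def trans_def gdelta_forcing_def)

lemma trans_gdelta_forcing: "trans (gdelta_forcing X)"
  using Preorder_gdelta_forcing by (auto simp: preorder_on_def)

lemma forcing_notion_gdelta_forcing:
  assumes "topspace X \<noteq> {}"
  shows "forcing_notion (gdelta_forcing X)"
proof -
  have "(topspace X, topspace X) \<in> gdelta_forcing X"
    using topspace_in_closed_gdeltas[OF assms] by (simp add: in_gdelta_forcing)
  then show ?thesis
    using Preorder_gdelta_forcing[of X] by (auto simp: forcing_notion_def)
qed

text \<open>A nonempty finite subfamily of a chain contains its own intersection, so the finite
  intersection property holds and compactness makes the whole intersection nonempty. Countability
  keeps it G-delta.\<close>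

lemma Inter_chain_in_closed_gdeltas:
  assumes X: "compact_space X" and C: "countable C" "C \<noteq> {}" "C \<subseteq> closed_gdeltas X"
    and chain: "\<And>E F. E \<in> C \<Longrightarrow> F \<in> C \<Longrightarrow> E \<subseteq> F \<or> F \<subseteq> E"
  shows "\<Inter>C \<in> closed_gdeltas X"
proof -
  have "\<Inter>\<F> \<noteq> {}" if "finite \<F>" "\<F> \<subseteq> C" for \<F>
  proof (cases "\<F> = {}")
    case False
    then have "\<Inter>\<F> \<in> \<F>"
      using that chain by (intro Inter_in_chain) (auto simp: subset.chain_def)
    then show ?thesis
      using that C by (auto simp: closed_gdeltas_def)
  qed simp
  moreover have "\<forall>E\<in>C. closedin X E"
    using C(3) by (auto simp: closed_gdeltas_def)
  ultimately have "\<Inter>C \<noteq> {}"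
    using X[unfolded compact_space_fip, rule_format, of C] by simp
  moreover have "closedin X (\<Inter>C)" "gdelta_in X (\<Inter>C)"
    using C by (auto simp: closed_gdeltas_def intro!: gdelta_in_Inter)
  ultimately show ?thesis
    by (simp add: closed_gdeltas_def)
qed

lemma countably_closed_gdelta_forcing:
  assumes X: "compact_space X" "topspace X \<noteq> {}"
  shows "countably_closed (gdelta_forcing X)"
  unfolding countably_closed_def Field_gdelta_forcing
proof (intro allI impI, elim conjE)
  fix \<alpha> :: "nat rel" and f
  assume wo: "Well_order \<alpha>" and f: "f ` Field \<alpha> \<subseteq> closed_gdeltas X"
    and dec: "\<forall>(i, j)\<in>\<alpha>. (f j, f i) \<in> gdelta_forcing X"
  show "\<exists>q\<in>closed_gdeltas X. \<forall>i\<in>Field \<alpha>. (q, f i) \<in> gdelta_forcing X"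
  proof (cases "Field \<alpha> = {}")
    \<comment> \<open>For the empty sequence any condition is a lower bound. The intersection of the
      empty family would be \<open>UNIV\<close>, so the whole space is taken instead.\<close>
    case True
    then show ?thesis
      using topspace_in_closed_gdeltas[OF X(2)] by auto
  next
    case False
    have "f i \<subseteq> f j \<or> f j \<subseteq> f i" if "i \<in> Field \<alpha>" "j \<in> Field \<alpha>" for i j
    proof (cases "i = j")
      case False
      then have "(i, j) \<in> \<alpha> \<or> (j, i) \<in> \<alpha>"
        using wo that by (simp add: well_order_on_def linear_order_on_def total_on_def)
      then show ?thesis
        using dec unfolding in_gdelta_forcing by blast
    qed simp
    then have "\<Inter>(f ` Field \<alpha>) \<in> closed_gdeltas X"
      using f False by (intro Inter_chain_in_closed_gdeltas[OF X(1)]) auto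
    with f show ?thesis
      by (intro bexI[of _ "\<Inter>(f ` Field \<alpha>)"]) (auto simp: in_gdelta_forcing)
  qed
qed

text \<open>The witness is the zero set of a continuous function into [0,1] that vanishes at
  \<open>y\<close> and is 1 on \<open>S\<close>.\<close>

lemma closed_gdelta_separation:
  assumes "completely_regular_space X" "closedin X S" "y \<in> topspace X" "y \<notin> S"
  obtains Z where "closedin X Z" "gdelta_in X Z" "y \<in> Z" "Z \<inter> S = {}"
proof -
  obtain f :: "'a \<Rightarrow> real" where f: "continuous_map X (top_of_set {0..1}) f" "f y = 0" "f ` S \<subseteq> {1}"
    using assms unfolding completely_regular_space_def by blast
  have f': "continuous_map X euclideanreal f"
    and f0: "\<And>z. z \<in> topspace X \<Longrightarrow> 0 \<le> f z"
    using f(1) by (auto simp: continuous_map_in_subtopology)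
  define Z where "Z = {z \<in> topspace X. f z \<in> {0}}"
  have "closedin X Z"
    unfolding Z_def using closedin_continuous_map_preimage[OF f', of "{0}"] by simp
  moreover have "gdelta_in X Z"
  proof -
    \<comment> \<open>Since \<open>f\<close> is nonnegative, its zeros are the points where it lies
      below every 1/(n+1), and each such strict bound defines an open set.\<close>
    have "Z = (\<Inter>n. {z \<in> topspace X. f z \<in> {..<inverse (real (Suc n))}})" (is "_ = (\<Inter>n. ?U n)")
    proof (intro equalityI subsetI)
      fix z assume z: "z \<in> (\<Inter>n. ?U n)"
      then have "z \<in> topspace X"
        by auto
      moreover have "\<not> f z > 0"
      proof
        assume "f z > 0"
        then obtain n where "inverse (real (Suc n)) < f z"
          using reals_Archimedean by blast
        moreover have "f z < inverse (real (Suc n))"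
          using z by blast
        ultimately show False
          by simp
      qed
      ultimately show "z \<in> Z"
        using f0[of z] by (auto simp: Z_def)
    qed (auto simp: Z_def)
    moreover have "gdelta_in X (?U n)" for n
      using openin_continuous_map_preimage[OF f', of "{..<inverse (real (Suc n))}"]
      by (intro open_imp_gdelta_in) simp
    ultimately show ?thesis
      by (auto intro!: gdelta_in_Inter)
  qed
  moreover have "y \<in> Z" "Z \<inter> S = {}"
    using assms f by (auto simp: Z_def)
  ultimately show thesis
    using that by blast
qed

text \<open>This is the density argument behind the cover. If \<open>x\<close> lies in
  \<open>F\<close>, then \<open>F\<close> has a second point \<open>y\<close>, because otherwise
  \<open>{x}\<close> would be the G-delta set \<open>F\<close>. A closed G-delta set around
  \<open>y\<close> that misses \<open>x\<close> then cuts \<open>F\<close> down.\<close>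

lemma shrink_to_miss_point:
  assumes X: "compact_space X" "Hausdorff_space X"
    and nongd: "\<And>x. x \<in> topspace X \<Longrightarrow> \<not> gdelta_in X {x}"
    and F: "F \<in> closed_gdeltas X"
  obtains E where "(E, F) \<in> gdelta_forcing X" "x \<notin> E"
proof (cases "x \<in> F")
  case True
  have F': "closedin X F" "gdelta_in X F"
    using F by (auto simp: closed_gdeltas_def)
  with True have x: "x \<in> topspace X"
    using closedin_subset[OF F'(1)] by blast
  then have "\<not> F \<subseteq> {x}"
    using nongd[OF x] F'(2) True subset_singletonD[of F x] by auto
  then obtain y where y: "y \<in> F" "y \<noteq> x"
    by auto
  have "completely_regular_space X"
    using X by (simp add: compact_Hausdorff_or_regular_imp_normal_space
        normal_imp_completely_regular_space)
  moreover have "closedin X {x}"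
    using X x by (simp add: closedin_Hausdorff_sing_eq)
  moreover have "y \<in> topspace X"
    using y closedin_subset[OF F'(1)] by blast
  moreover have "y \<notin> {x}"
    using y by simp
  ultimately obtain Z where "closedin X Z" "gdelta_in X Z" "y \<in> Z" "Z \<inter> {x} = {}"
    by (rule closed_gdelta_separation)
  then have "F \<inter> Z \<in> closed_gdeltas X" "x \<notin> F \<inter> Z"
    using F' y by (auto simp: closed_gdeltas_def intro: gdelta_in_Int)
  then show ?thesis
    using F by (intro that[of "F \<inter> Z"]) (simp_all add: in_gdelta_forcing)
next
  case False
  then show ?thesis
    using F by (intro that[of F]) (simp_all add: in_gdelta_forcing)
qed

section \<open>The generic cover\<close>

text \<open>In the extension by a generic filter G this names the family of all X - F with F in G:
  the condition \<open>F\<close> itself decides that its complement enters.\<close>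

definition generic_cover :: "'a topology \<Rightarrow> (('a, 'a set) pname, 'a set) pname" where
  "generic_cover X =
     {(check (gdelta_forcing X) (topspace X - F), F) | F. F \<in> closed_gdeltas X}"

context
  fixes X :: "'a topology"
begin

abbreviation "\<P> \<equiv> gdelta_forcing X"
abbreviation chk :: "'a set \<Rightarrow> ('a, 'a set) pname" where
  "chk \<equiv> check \<P>"
abbreviation gmem :: "'a \<Rightarrow> ('a, 'a set) pname \<Rightarrow> 'a set sentence" where
  "gmem \<equiv> mem \<P> eq_ground"
abbreviation geq :: "('a, 'a set) pname \<Rightarrow> ('a, 'a set) pname \<Rightarrow> 'a set sentence" where
  "geq \<equiv> eq_set \<P> eq_ground"

lemma forcing_refl: "p \<in> closed_gdeltas X \<Longrightarrow> (p, p) \<in> \<P>"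
  by (simp add: in_gdelta_forcing)

lemma mem_chk_iff: "p \<in> closed_gdeltas X \<Longrightarrow> gmem x (chk A) p \<longleftrightarrow> x \<in> A"
  using mem_check_iff[OF Preorder_gdelta_forcing, of p X x A] by (simp add: Field_gdelta_forcing)

lemma gmem_geq: "p \<in> closed_gdeltas X \<Longrightarrow> geq U V p \<Longrightarrow> gmem x U p \<Longrightarrow> gmem x V p"
  using mem_eq_set[OF Preorder_gdelta_forcing, of p X U V x] by (simp add: Field_gdelta_forcing)

text \<open>Forced membership only provides densely many conditions that identify the member;
  applying the density at \<open>p\<close> yields one of them, which lies below the corresponding
  \<open>F\<close>.\<close>

lemma generic_cover_member:
  assumes "mem \<P> geq U (generic_cover X) p" "p \<in> closed_gdeltas X"
  obtains r F where "(r, p) \<in> \<P>" "(r, F) \<in> \<P>" "geq U (chk (topspace X - F)) r"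
proof -
  obtain r \<pi> s where "(r, p) \<in> \<P>" "(\<pi>, s) \<in> generic_cover X" "(r, s) \<in> \<P>" "geq U \<pi> r"
    using assms(1) forcing_refl[OF assms(2)] unfolding mem_def by blast
  then show thesis
    using that unfolding generic_cover_def by blast
qed

lemma ext_open_chk:
  assumes "openin X B" "p \<in> closed_gdeltas X" "geq U (chk B) p"
  shows "ext_open \<P> X U p"
proof -
  \<comment> \<open>Below \<open>p\<close>, membership in \<open>U\<close> amounts to membership in
    the ground-model set \<open>B\<close>; facts 1 and 2 are the two directions.\<close>
  have 1: "gmem y U r" if "y \<in> B" "(r, p) \<in> \<P>" for y r
    using that assms eq_set_mono[OF trans_gdelta_forcing assms(3) that(2)]
    by (metis eq_set_sym gmem_geq in_gdelta_forcing mem_chk_iff)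
  have 2: "y \<in> B" if "gmem y U r" "(r, p) \<in> \<P>" for y r
    using that assms eq_set_mono[OF trans_gdelta_forcing assms(3) that(2)]
    by (metis gmem_geq in_gdelta_forcing mem_chk_iff)
  have tr: "(r, p) \<in> \<P>" if "(r, q) \<in> \<P>" "(q, p) \<in> \<P>" for p q r
    using that trans_gdelta_forcing by (meson transD)
  have 3: "q \<in> closed_gdeltas X" "(q, q) \<in> \<P>" if "(q, p) \<in> \<P>" for p q
    using that by (auto simp: in_gdelta_forcing)
  show ?thesis
    unfolding ext_open_def
  proof (rule fall_iff[THEN iffD2], intro ballI, rule fimp_iff[THEN iffD2], intro allI impI)
    fix x q assume q: "(q, p) \<in> \<P>" "gmem x U q"
    then have x: "x \<in> B"
      using 2 by blast
    \<comment> \<open>\<open>B\<close> itself serves as the basic neighbourhood of every point of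
      \<open>U\<close>.\<close>
    have "\<exists>s. (s, r) \<in> \<P> \<and> (gmem x (chk B) fand
        fall UNIV (\<lambda>y. fimp \<P> (gmem y (chk B)) (gmem y U))) s" if r: "(r, q) \<in> \<P>" for r
    proof (intro exI conjI)
      show "(r, r) \<in> \<P>"
        using 3[OF r] by blast
      have "\<exists>t. (t, s) \<in> \<P> \<and> gmem y U t" if "(s, r) \<in> \<P>" "gmem y (chk B) s" for s y
      proof -
        have "y \<in> B"
          using that(2) mem_chk_iff[OF 3(1)[OF that(1)]] by simp
        then show ?thesis
          using 1 tr[OF that(1) tr[OF r q(1)]] 3(2)[OF that(1)] by blast
      qed
      then show "(gmem x (chk B) fand
          fall UNIV (\<lambda>y. fimp \<P> (gmem y (chk B)) (gmem y U))) r"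
        using x 3[OF r] by (simp add: fand_iff fall_iff fimp_iff mem_chk_iff)
    qed
    then have "fex \<P> {B. openin X B} (\<lambda>B. gmem x (chk B) fand
        fall UNIV (\<lambda>y. fimp \<P> (gmem y (chk B)) (gmem y U))) q"
      using assms(1) unfolding fex_iff by blast
    then show "\<exists>r. (r, q) \<in> \<P> \<and> fex \<P> {B. openin X B} (\<lambda>B. gmem x (chk B) fand
        fall UNIV (\<lambda>y. fimp \<P> (gmem y (chk B)) (gmem y U))) r"
      using 3[OF q(1)] by blast
  qed
qed

lemma generic_cover_open:
  assumes "p \<in> closed_gdeltas X"
  shows "fall UNIV (\<lambda>U. fimp \<P> (mem \<P> geq U (generic_cover X)) (ext_open \<P> X U)) p"
  unfolding fall_iff fimp_iff
proof (intro ballI allI impI)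
  fix U q assume q: "(q, p) \<in> \<P>" "mem \<P> geq U (generic_cover X) q"
  then obtain r F where r: "(r, q) \<in> \<P>" "(r, F) \<in> \<P>" "geq U (chk (topspace X - F)) r"
    by (metis generic_cover_member in_gdelta_forcing)
  moreover have "openin X (topspace X - F)"
    using r by (auto simp: in_gdelta_forcing closed_gdeltas_def)
  ultimately show "\<exists>r. (r, q) \<in> \<P> \<and> ext_open \<P> X U r"
    using ext_open_chk by (metis in_gdelta_forcing)
qed

lemma generic_cover_covers:
  assumes X: "compact_space X" "Hausdorff_space X"
    and nongd: "\<And>x. x \<in> topspace X \<Longrightarrow> \<not> gdelta_in X {x}"
    and p: "p \<in> closed_gdeltas X"
  shows "ext_covers \<P> X (generic_cover X) p"
  unfolding ext_covers_def fall_iff fiff_iff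
proof (intro ballI conjI)
  fix x
  show "fimp \<P> (fex \<P> UNIV (\<lambda>U. mem \<P> geq U (generic_cover X) fand gmem x U))
      (gmem x (chk (topspace X))) p"
    unfolding fimp_iff
  proof (intro allI impI)
    fix q assume q: "(q, p) \<in> \<P>"
      "fex \<P> UNIV (\<lambda>U. mem \<P> geq U (generic_cover X) fand gmem x U) q"
    then have q': "q \<in> closed_gdeltas X"
      by (simp add: in_gdelta_forcing)
    then obtain U r where r: "(r, q) \<in> \<P>" "mem \<P> geq U (generic_cover X) r" "gmem x U r"
      using q(2) forcing_refl unfolding fex_iff fand_iff by metis
    obtain s F where s: "(s, r) \<in> \<P>" "geq U (chk (topspace X - F)) s"
      using generic_cover_member r(1,2) by (metis in_gdelta_forcing)
    \<comment> \<open>The conclusion concerns only the ground model, so although it was found at the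
      stronger condition \<open>s\<close>, it can be used at \<open>q\<close>.\<close>
    have "x \<in> topspace X - F"
      using gmem_geq[OF _ s(2) mem_mono[OF trans_gdelta_forcing r(3) s(1)]] s(1)
      by (simp add: in_gdelta_forcing mem_chk_iff)
    then show "\<exists>r. (r, q) \<in> \<P> \<and> gmem x (chk (topspace X)) r"
      using forcing_refl[OF q'] mem_chk_iff[OF q'] by auto
  qed
  show "fimp \<P> (gmem x (chk (topspace X)))
      (fex \<P> UNIV (\<lambda>U. mem \<P> geq U (generic_cover X) fand gmem x U)) p"
    unfolding fimp_iff
  proof (intro allI impI)
    fix q assume q: "(q, p) \<in> \<P>" "gmem x (chk (topspace X)) q"
    from q(1) have q': "q \<in> closed_gdeltas X"
      by (simp add: in_gdelta_forcing)
    with q(2) have x: "x \<in> topspace X"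
      by (simp add: mem_chk_iff)
    have "fex \<P> UNIV (\<lambda>U. mem \<P> geq U (generic_cover X) fand gmem x U) q"
      unfolding fex_iff fand_iff
    proof (intro allI impI)
      fix r assume "(r, q) \<in> \<P>"
      then obtain E where E: "(E, r) \<in> \<P>" "x \<notin> E"
        using shrink_to_miss_point[OF X nongd, of r x] by (auto simp: in_gdelta_forcing)
      then have E': "E \<in> closed_gdeltas X"
        by (simp add: in_gdelta_forcing)
      \<comment> \<open>The pair of this name with the condition \<open>E\<close> belongs to
        \<open>generic_cover X\<close>, so \<open>E\<close> and everything below it put the
        complement of \<open>E\<close> into the cover.\<close>
      have "mem \<P> geq (chk (topspace X - E)) (generic_cover X) E"
        unfolding mem_def
      proof (intro allI impI exI conjI)
        fix q assume "(q, E) \<in> \<P>"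
        then show "(q, q) \<in> \<P>"
          "\<exists>(\<pi>, s)\<in>generic_cover X.
            (q, s) \<in> \<P> \<and> geq (chk (topspace X - E)) \<pi> q"
          using E'
          by (auto simp: in_gdelta_forcing eq_set_refl generic_cover_def
              intro!: bexI[of _ "(chk (topspace X - E), E)"])
      qed
      moreover have "gmem x (chk (topspace X - E)) E"
        using E' E x by (simp add: mem_chk_iff)
      ultimately show "\<exists>U\<in>UNIV. \<exists>s. (s, r) \<in> \<P> \<and> mem \<P> geq U (generic_cover X) s \<and> gmem x U s"
        using E(1) by blast
    qed
    then show "\<exists>r. (r, q) \<in> \<P> \<and>
        fex \<P> UNIV (\<lambda>U. mem \<P> geq U (generic_cover X) fand gmem x U) r"
      using q' forcing_refl by blast
  qed
qed

text \<open>The enumeration exists only as a name \<open>f\<close>, so its values are handled one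
  index at a time along a decreasing sequence of conditions. A point of the intersection of the
  sequence is then forced to lie in no member of \<open>\<V>\<close>.\<close>

lemma generic_cover_no_countable_subcover:
  assumes X: "compact_space X"
    and p: "p \<in> closed_gdeltas X"
    and ctble: "ext_countable \<P> \<V> p"
    and sub: "ext_subset \<P> \<V> (generic_cover X) p"
    and cov: "ext_covers \<P> X \<V> p"
  shows False
proof -
  obtain f q\<^sub>0 where q0: "(q\<^sub>0, p) \<in> \<P>"
    and f: "(fall UNIV (\<lambda>V. fiff \<P> (mem \<P> geq V \<V>)
          (fex \<P> UNIV (\<lambda>n. mem \<P> (eq_pair geq eq_ground) (V, n) f))) fand
        fall UNIV (\<lambda>V. fall UNIV (\<lambda>m. fall UNIV (\<lambda>n. fimp \<P>
          (mem \<P> (eq_pair geq eq_ground) (V, m) f fand mem \<P> (eq_pair geq eq_ground) (V, n) f)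
          (eq_ground m n)))) fand
        fall UNIV (\<lambda>V. fall UNIV (\<lambda>W. fall UNIV (\<lambda>n :: nat. fimp \<P>
          (mem \<P> (eq_pair geq eq_ground) (V, n) f fand mem \<P> (eq_pair geq eq_ground) (W, n) f)
          (geq V W))))) q\<^sub>0"
    using ctble forcing_refl[OF p] unfolding ext_countable_def Let_def by (elim fexE)
  define app where "app V n = mem \<P> (eq_pair geq eq_ground) (V, n) f" for V and n :: nat
  \<comment> \<open>Two clauses on \<open>f\<close> are extracted: its domain is
    \<open>\<V>\<close>, and names with the same number are forced equal. The latter carries
    information about one name of the \<open>n\<close>-th member over to all its names.\<close>
  have dom: "fimp \<P> (mem \<P> geq V \<V>) (fex \<P> UNIV (app V)) q\<^sub>0"
      "fimp \<P> (fex \<P> UNIV (app V)) (mem \<P> geq V \<V>) q\<^sub>0"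
    and inj: "fimp \<P> (app V n fand app W n) (geq V W) q\<^sub>0" for V W n
    using f by (auto simp: fand_iff fall_iff fiff_iff app_def[abs_def])
  have app_mono: "app V n r" if "app V n q" "(r, q) \<in> \<P>" for V n q r
    using that mem_mono[OF trans_gdelta_forcing] unfolding app_def by metis
  have tr: "(r, p) \<in> \<P>" if "(r, q) \<in> \<P>" "(q, p) \<in> \<P>" for p q r
    using that trans_gdelta_forcing by (meson transD)
  have q0': "q\<^sub>0 \<in> closed_gdeltas X"
    using q0 by (simp add: in_gdelta_forcing)

  \<comment> \<open>A condition \<open>q\<close> with \<open>avoids n q\<close> forces that the \<open>n\<close>-th member of \<open>\<V>\<close> is disjoint from \<open>q\<close>.\<close>
  define avoids where "avoids n q \<longleftrightarrow>
      (\<forall>W r x. (r, q) \<in> \<P> \<longrightarrow> x \<in> q \<longrightarrow> app W n r \<longrightarrow> \<not> gmem x W r)" for n q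
  have step: "\<exists>q. (q, r) \<in> \<P> \<and> avoids n q" if r: "(r, q\<^sub>0) \<in> \<P>" for n r
  proof (cases "\<exists>W s. (s, r) \<in> \<P> \<and> app W n s")
    \<comment> \<open>If nothing below \<open>r\<close> gives any set the number \<open>n\<close>,
      then \<open>r\<close> avoids \<open>n\<close> vacuously.\<close>
    case False
    then show ?thesis
      using r by (intro exI[of _ r]) (auto simp: avoids_def in_gdelta_forcing)
  next
    case True
    \<comment> \<open>Successive strengthenings name the \<open>n\<close>-th member by
      \<open>W\<close> (\<open>s\<close>), put it into \<open>\<V>\<close> (\<open>t\<close>) and
      into the generic cover (\<open>u\<close>), and identify it as the complement of some
      \<open>F\<close> (\<open>v\<close>).\<close>
    then obtain W s where s: "(s, r) \<in> \<P>" "app W n s"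
      by blast
    have "fex \<P> UNIV (app W) s"
      using app_mono[OF s(2)] forcing_refl by (auto simp: fex_iff in_gdelta_forcing)
    then obtain t where t: "(t, s) \<in> \<P>" "mem \<P> geq W \<V> t"
      using fimpE[OF dom(2)[of W] tr[OF s(1) r]] by blast
    have "(t, p) \<in> \<P>"
      using t s r q0 tr by blast
    then obtain u where u: "(u, t) \<in> \<P>" "mem \<P> geq W (generic_cover X) u"
      using fimpE[OF fallD[OF sub[unfolded ext_subset_def] UNIV_I], of t W] t(2) by blast
    obtain v F where v: "(v, u) \<in> \<P>" "(v, F) \<in> \<P>" "geq W (chk (topspace X - F)) v"
      using generic_cover_member u by (metis in_gdelta_forcing)
    have vs: "(v, s) \<in> \<P>"
      using v t u tr by blast
    \<comment> \<open>The condition \<open>v\<close> is contained in \<open>F\<close> and forces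
      \<open>W\<close> to be the complement of \<open>F\<close>. Any other name \<open>W'\<close>
      with number \<open>n\<close> below \<open>v\<close> is forced equal to \<open>W\<close> by
      injectivity, hence also misses \<open>v\<close>.\<close>
    have "avoids n v"
      unfolding avoids_def
    proof (intro allI impI notI)
      fix W' w x
      assume w: "(w, v) \<in> \<P>" and x: "x \<in> v" "app W' n w" "gmem x W' w"
      have "app W n w" "(w, q\<^sub>0) \<in> \<P>"
        using app_mono[OF s(2)] tr[OF w vs] tr[OF _ tr[OF s(1) r]] by blast+
      then obtain w' where w': "(w', w) \<in> \<P>" "geq W' W w'"
        using fimpE[OF inj, of w W' n W] x(2) by (auto simp: fand_iff)
      then have "w' \<in> closed_gdeltas X"
        by (simp add: in_gdelta_forcing)
      moreover have "gmem x W' w'"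
        using mem_mono[OF trans_gdelta_forcing x(3) w'(1)] .
      moreover have "geq W (chk (topspace X - F)) w'"
        using eq_set_mono[OF trans_gdelta_forcing v(3) tr[OF w'(1) w]] .
      ultimately have "x \<in> topspace X - F"
        using w'(2) by (metis gmem_geq mem_chk_iff)
      then show False
        using x(1) v(2) by (auto simp: in_gdelta_forcing)
    qed
    moreover have "(v, r) \<in> \<P>"
      using vs s tr by blast
    ultimately show ?thesis
      by blast
  qed
  \<comment> \<open>Dependent choice starts below \<open>q\<^sub>0\<close> and treats index
    \<open>Suc n\<close> below \<open>g n\<close>.\<close>
  have "\<exists>g. \<forall>n. ((g n, q\<^sub>0) \<in> \<P> \<and> avoids n (g n)) \<and> (g (Suc n), g n) \<in> \<P>"
    using step forcing_refl[OF q0'] tr by (intro dependent_nat_choice) blast+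
  then obtain g where g: "\<And>n. (g n, q\<^sub>0) \<in> \<P>" "\<And>n. avoids n (g n)" "\<And>n. (g (Suc n), g n) \<in> \<P>"
    by blast
  have "decseq g"
    using g(3) by (intro decseq_SucI) (simp add: in_gdelta_forcing)
  then have "\<Inter>(range g) \<in> closed_gdeltas X"
    using g(1) by (intro Inter_chain_in_closed_gdeltas[OF X])
      (auto simp: in_gdelta_forcing dest: decseqD intro: linear, metis decseqD linear subsetD)
  then have lim: "(\<Inter>(range g), g n) \<in> \<P>" for n
    using g(1) by (auto simp: in_gdelta_forcing)
  \<comment> \<open>A ground-model point common to all \<open>g n\<close>; the intersection, being a
    condition, is nonempty.\<close>
  then obtain x where x: "\<And>n. x \<in> g n" "x \<in> topspace X"
    by (fastforce simp: in_gdelta_forcing closed_gdeltas_def dest: closedin_subset)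
  have "\<Inter>(range g) \<in> closed_gdeltas X"
    using lim by (simp add: in_gdelta_forcing)
  then have "gmem x (chk (topspace X)) (\<Inter>(range g))"
    using x by (simp add: mem_chk_iff)
  then obtain r where r: "(r, \<Inter>(range g)) \<in> \<P>"
      "fex \<P> UNIV (\<lambda>U. mem \<P> geq U \<V> fand gmem x U) r"
    using fimpE[OF fiff_iff[THEN iffD1, THEN conjunct2,
          OF fallD[OF cov[unfolded ext_covers_def] UNIV_I]] tr[OF lim tr[OF g(1) q0]]]
    by blast
  then have "(r, r) \<in> \<P>"
    by (simp add: in_gdelta_forcing)
  \<comment> \<open>Below the intersection, \<open>s\<close> names a member \<open>U\<close> of
    \<open>\<V>\<close> that covers \<open>x\<close>, and further strengthening to \<open>u\<close>
    determines its number \<open>n\<close>.\<close>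
  then obtain U s where s: "(s, r) \<in> \<P>" "mem \<P> geq U \<V> s" "gmem x U s"
    using fexE[OF r(2)] unfolding fand_iff by blast
  have "(s, q\<^sub>0) \<in> \<P>"
    by (rule tr[OF s(1) tr[OF r(1) tr[OF lim g(1)]]])
  then obtain t where t: "(t, s) \<in> \<P>" "fex \<P> UNIV (app U) t"
    using fimpE[OF dom(1)[of U] _ s(2)] by blast
  then have "(t, t) \<in> \<P>"
    by (simp add: in_gdelta_forcing)
  then obtain n u where u: "(u, t) \<in> \<P>" "app U n u"
    using fexE[OF t(2)] by blast
  have us: "(u, s) \<in> \<P>"
    by (rule tr[OF u(1) t(1)])
  \<comment> \<open>The number \<open>n\<close> becomes known only here, after the sequence has been
    built. Since \<open>u\<close> lies below the intersection, it lies below \<open>g n\<close> for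
    this \<open>n\<close>, whose avoidance is contradicted.\<close>
  then have "(u, g n) \<in> \<P>"
    using tr[OF _ tr[OF s(1) tr[OF r(1) lim]]] by blast
  moreover have "gmem x U u"
    using mem_mono[OF trans_gdelta_forcing s(3) us] .
  ultimately show False
    using g(2) x(1) u(2) unfolding avoids_def by blast
qed

end

theorem theorem1p12:
  fixes X :: "'a topology"
  assumes "compact_space X"
    and "Hausdorff_space X"
    and "topspace X \<noteq> {}"
    and "\<And>x. x \<in> topspace X \<Longrightarrow> \<not> gdelta_in X {x}"
  shows "destructible TYPE('a set) X"
proof -
  let ?P = "gdelta_forcing X"
  have top: "topspace X \<in> closed_gdeltas X"
    using assms(3) by (rule topspace_in_closed_gdeltas)
  \<comment> \<open>The whole space is the weakest condition, and the Lindelof property already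
    fails to be forced there.\<close>
  have "\<not> ext_Lindelof ?P X (topspace X)"
  proof
    assume L: "ext_Lindelof ?P X (topspace X)"
    have "(topspace X, topspace X) \<in> ?P"
      using top by (simp add: in_gdelta_forcing)
    moreover have "(fall UNIV (\<lambda>U. fimp ?P (mem ?P (eq_set ?P eq_ground) U (generic_cover X))
        (ext_open ?P X U)) fand ext_covers ?P X (generic_cover X)) (topspace X)"
      using generic_cover_open[OF top] generic_cover_covers[OF assms(1,2) _ top] assms(4)
      by (simp only: fand_iff) blast
    ultimately obtain p where p: "(p, topspace X) \<in> ?P"
      "fex ?P UNIV (\<lambda>\<V>. ext_countable ?P \<V> fand ext_subset ?P \<V> (generic_cover X)
         fand ext_covers ?P X \<V>) p"
      by (rule fimpE[OF fallD[OF L[unfolded ext_Lindelof_def] UNIV_I]])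
    then have "(p, p) \<in> ?P"
      by (simp add: in_gdelta_forcing)
    then obtain \<V> q where "(q, p) \<in> ?P" "ext_countable ?P \<V> q"
      "ext_subset ?P \<V> (generic_cover X) q" "ext_covers ?P X \<V> q"
      using fexE[OF p(2)] unfolding fand_iff by blast
    then show False
      using generic_cover_no_countable_subcover[OF assms(1), of q \<V>]
      by (simp add: in_gdelta_forcing)
  qed
  then have "\<not> indestructible TYPE('a set) X"
    using forcing_notion_gdelta_forcing[OF assms(3)]
      countably_closed_gdelta_forcing[OF assms(1,3)] top Field_gdelta_forcing[of X]
    unfolding indestructible_def by blast
  then show ?thesis
    using compact_imp_Lindelof_space[OF assms(1)] by (simp add: destructible_def)
qed

end
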